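(* Let $\mathbb{A}$ be a dense, divisible additive subgroup of $\mathbb{R}$, and let $S:\mathbb{A}\rightarrow\mathbb{R}$ be locally bounded and sublinear (in particular, $S$ may be additive). Then the formulas $$S_{\mathbb{A}}^{+}(x):=\lim_{\delta\to 0}\sup\{S(t):t\in B_{\delta}(x)\cap\mathbb{A}\},\qquad S_{\mathbb{A}}^{-}(x):=\lim_{\delta\to 0}\inf\{S(t):t\in B_{\delta}(x)\cap\mathbb{A}\}\qquad(x\in\mathbb{R})$$ define locally bounded, subadditive, indeed sublinear, functions $S_{\mathbb{A}}^{\pm}:\mathbb{R}\rightarrow\mathbb{R}$ with $$S_{\mathbb{A}}^{-}(x)\le S_{\mathbb{A}}^{+}(x)\quad(x\in\mathbb{R})\qquad\text{and}\qquad S_{\mathbb{A}}^{-}(a)\le S(a)\le S_{\mathbb{A}}^{+}(a)\quad(a\in\mathbb{A}).$$ Hence: (i) $S_{\mathbb{A}}^{+}|\mathbb{R}_{+}=S_{\mathbb{A}}^{-}|\mathbb{R}_{+}$ and $S_{\mathbb{A}}^{+}|\mathbb{R}_{-}=S_{\mathbb{A}}^{-}|\mathbb{R}_{-}$; (ii) each of $S_{\mathbb{A}}^{+}$ and $S_{\mathbb{A}}^{-}$ is linear on $\mathbb{R}_{+}$ and is linear on $\mathbb{R}_{-}$, and $S$ is linear on $\mathbb{A}_{+}$ and is linear on $\mathbb{A}_{-}$; (iii) $S_{\mathbb{A}}^{+}|\mathbb{A}=S$ and $S_{\mathbb{A}}^{-}|\mathbb{A}=S$; (iv) in particular, if $S$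 is additive, then $S_{\mathbb{A}}^{+}=S_{\mathbb{A}}^{-}$ and this function is linear on $\mathbb{R}$, as is also $S=S_{\mathbb{A}}^{+}|\mathbb{A}$ on $\mathbb{A}$.
   Context: Notation: $B_{\delta}(x):=(x-\delta,x+\delta)$, $\mathbb{R}_{+}:=[0,\infty)$, $\mathbb{R}_{-}:=(-\infty,0]$, $\mathbb{A}_{\pm}:=\mathbb{A}\cap\mathbb{R}_{\pm}$. The subgroup $\mathbb{A}$ is divisible if $a/k\in\mathbb{A}$ for all $a\in\mathbb{A}$ and all $k\in\mathbb{N}$, $k\ge1$. For $G=\mathbb{R}$ or $G$ an additive subgroup of $\mathbb{R}$, a function $S:G\to\mathbb{R}$ is subadditive if $S(x+y)\le S(x)+S(y)$ for all $x,y\in G$; it is sublinear if it is subadditive and $S(nx)=nS(x)$ for all $x\in G$ and $n=0,1,2,\dots$ (homogeneity is required only for non-negative integers). It is additive if $S(x+y)=S(x)+S(y)$ for all $x,y\in G$. Locally bounded means bounded on (the intersection of $G$ with) some neighbourhood of each point. A function on a set $D\subseteq\mathbb{R}$ is linear (on $D$) if there is $c\in\mathbb{R}$ with the function equal to $cx$ for all $x\in D$; the constant $c$ may differ for $D=\mathbb{R}_{+}$ and $D=\mathbb{R}_{-}$. *)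

theory Defs
  imports "HOL-Analysis.Analysis"
begin

text \<open>A function on a set \<open>G\<close> of reals is rendered as a total function of type
  \<open>real \<Rightarrow> real\<close>; every notion below depends only on its values on \<open>G\<close>.\<close>

definition real_subgroup :: "real set \<Rightarrow> bool" where
  "real_subgroup A \<longleftrightarrow> 0 \<in> A \<and> (\<forall>x\<in>A. \<forall>y\<in>A. x + y \<in> A) \<and> (\<forall>x\<in>A. - x \<in> A)"

definition divisible_set :: "real set \<Rightarrow> bool" where
  "divisible_set A \<longleftrightarrow> (\<forall>a\<in>A. \<forall>k::nat. k \<ge> 1 \<longrightarrow> a / real k \<in> A)"

definition subadditive_on :: "real set \<Rightarrow> (real \<Rightarrow> real) \<Rightarrow> bool" where
  "subadditive_on G S \<longleftrightarrow> (\<forall>x\<in>G. \<forall>y\<in>G. S (x + y) \<le> S x + S y)"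

text \<open>Homogeneity is required for non-negative integer factors only.\<close>

definition sublinear_on :: "real set \<Rightarrow> (real \<Rightarrow> real) \<Rightarrow> bool" where
  "sublinear_on G S \<longleftrightarrow>
     subadditive_on G S \<and> (\<forall>x\<in>G. \<forall>n::nat. S (real n * x) = real n * S x)"

definition additive_on :: "real set \<Rightarrow> (real \<Rightarrow> real) \<Rightarrow> bool" where
  "additive_on G S \<longleftrightarrow> (\<forall>x\<in>G. \<forall>y\<in>G. S (x + y) = S x + S y)"

lemma additive_on_imp_sublinear_on:
  assumes A: "real_subgroup A" and S: "additive_on A S"
  shows "sublinear_on A S"
proof -
  have S0: "S 0 = 0"
    using A S unfolding real_subgroup_def additive_on_def by (metis add.right_neutral add_cancel_right_right)
  have "real n * x \<in> A \<and> S (real n * x) = real n * S x" if x: "x \<in> A" for x and n :: nat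
  proof (induction n)
    case 0
    then show ?case using A S0 by (simp add: real_subgroup_def)
  next
    case (Suc n)
    have eq: "real (Suc n) * x = x + real n * x" by (simp add: algebra_simps)
    have "x + real n * x \<in> A" using A x Suc by (simp add: real_subgroup_def)
    moreover have "S (x + real n * x) = S x + real n * S x"
      using S x Suc by (simp add: additive_on_def)
    ultimately show ?case unfolding eq by (simp add: algebra_simps)
  qed
  then show ?thesis
    using S by (simp add: sublinear_on_def subadditive_on_def additive_on_def)
qed

text \<open>Boundedness is required near the points of the domain \<open>G\<close> only, not near those of its closure.\<close>

definition locally_bounded_on :: "real set \<Rightarrow> (real \<Rightarrow> real) \<Rightarrow> bool" where
  "locally_bounded_on G S \<longleftrightarrow> (\<forall>x\<in>G. \<exists>U. open U \<and> x \<in> U \<and> bounded (S ` (U \<inter> G)))"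

definition is_linear_on :: "real set \<Rightarrow> (real \<Rightarrow> real) \<Rightarrow> bool" where
  "is_linear_on D S \<longleftrightarrow> (\<exists>c. \<forall>x\<in>D. S x = c * x)"

text \<open>Suprema and infima are taken in \<^typ>\<open>ereal\<close>, where they always exist: for large \<open>\<delta>\<close> the set of
  values may be unbounded, and on \<^typ>\<open>real\<close> its supremum would be meaningless.\<close>

definition sup_near :: "real set \<Rightarrow> (real \<Rightarrow> real) \<Rightarrow> real \<Rightarrow> real \<Rightarrow> ereal" where
  "sup_near A S x \<delta> = (SUP t \<in> ball x \<delta> \<inter> A. ereal (S t))"

definition inf_near :: "real set \<Rightarrow> (real \<Rightarrow> real) \<Rightarrow> real \<Rightarrow> real \<Rightarrow> ereal" where
  "inf_near A S x \<delta> = (INF t \<in> ball x \<delta> \<inter> A. ereal (S t))"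

text \<open>The two limits as real-valued functions. These values are meaningful only where the limits
  exist and are finite, which has to be claimed separately.\<close>

definition upper_ext :: "real set \<Rightarrow> (real \<Rightarrow> real) \<Rightarrow> real \<Rightarrow> real" where
  "upper_ext A S x = real_of_ereal (Lim (at_right 0) (sup_near A S x))"

definition lower_ext :: "real set \<Rightarrow> (real \<Rightarrow> real) \<Rightarrow> real \<Rightarrow> real" where
  "lower_ext A S x = real_of_ereal (Lim (at_right 0) (inf_near A S x))"

end

theory Submission
  imports Defs
begin

text \<open>
  Local boundedness at \<open>0\<close>, homogeneity and divisibility give \<open>\<bar>S t\<bar> \<le> C * \<bar>t\<bar>\<close> on \<open>A\<close>. If \<open>a, b \<in> A\<close>
  have the same sign, then \<open>n * b\<close> lies within \<open>\<bar>a\<bar>\<close> of some multiple \<open>m * a\<close>, so by subadditivity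
  \<open>n * S b\<close> and \<open>n * (b / a) * S a\<close> differ by a bound independent of \<open>n\<close>; hence
  \<open>S b = (b / a) * S a\<close>. Thus \<open>S\<close> agrees on \<open>A\<close> with \<open>x \<mapsto> max (p * x) (q * x)\<close> for some
  \<open>q \<le> p\<close>. This function is continuous on the whole line, so by density both
  extensions coincide with it.
\<close>

text \<open>This Archimedean argument turns estimates with an error independent of \<open>n\<close>
  into exact ones: dividing by \<open>n\<close> makes the error vanish.\<close>

lemma le_zero_if_nat_multiples_bounded:
  fixes z K :: real
  assumes "\<And>n::nat. real n * z \<le> K"
  shows "z \<le> 0"
proof (rule ccontr)
  assume "\<not> z \<le> 0"
  then obtain n :: nat where "K < real n * z"
    using reals_Archimedean3[of z] by auto
  then show False using assms[of n] by simp
qed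

lemma subgroup_diff: "real_subgroup A \<Longrightarrow> x \<in> A \<Longrightarrow> y \<in> A \<Longrightarrow> x - y \<in> A"
  unfolding real_subgroup_def by (metis diff_conv_add_uminus)

lemma subgroup_nat_mult:
  assumes "real_subgroup A" "x \<in> A"
  shows "real n * x \<in> A"
  using assms by (induction n) (auto simp: real_subgroup_def algebra_simps)

lemma sublinear_on_zero: "real_subgroup A \<Longrightarrow> sublinear_on A S \<Longrightarrow> S 0 = 0"
  unfolding sublinear_on_def real_subgroup_def by (metis mult_zero_left of_nat_0)

text \<open>Divisibility lets every \<open>t\<close> be shrunk into a neighbourhood of 0 where
  \<open>S\<close> is bounded; homogeneity scales that bound back up. The result is affine in the
  modulus of \<open>t\<close>, and evaluating it at large multiples of \<open>t\<close> removes its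
  constant term.\<close>

lemma sublinear_on_linear_bound:
  assumes A: "real_subgroup A" and div: "divisible_set A"
    and lb: "locally_bounded_on A S" and S: "sublinear_on A S"
  obtains C where "C \<ge> 0" "\<And>t. t \<in> A \<Longrightarrow> \<bar>S t\<bar> \<le> C * \<bar>t\<bar>"
proof -
  have hom: "S (real n * x) = real n * S x" if "x \<in> A" for x n
    using S that by (simp add: sublinear_on_def)
  obtain U where U: "open U" "0 \<in> U" "bounded (S ` (U \<inter> A))"
    using lb A by (auto simp: locally_bounded_on_def real_subgroup_def)
  obtain M where M: "M > 0" "\<And>t. t \<in> U \<inter> A \<Longrightarrow> \<bar>S t\<bar> \<le> M"
    using U(3) unfolding bounded_pos by auto
  obtain d where d: "d > 0" "ball 0 d \<subseteq> U"
    using U(1,2) open_contains_ball by blast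
  have bound: "\<bar>S t\<bar> \<le> (\<bar>t\<bar> / d + 1) * M" if t: "t \<in> A" for t
  proof -
    \<comment> \<open>This is the least natural number strictly above
      \<open>\<bar>t\<bar> / d\<close>. The added 1 puts \<open>t / real n\<close> inside the open
      ball and keeps \<open>n\<close> positive even for \<open>t = 0\<close>.\<close>
    define n where "n = nat \<lfloor>\<bar>t\<bar> / d\<rfloor> + 1"
    have n: "\<bar>t\<bar> / d < real n" "real n \<le> \<bar>t\<bar> / d + 1" "n \<ge> 1"
      using d(1) unfolding n_def by (auto simp: of_nat_nat floor_le_iff) linarith
    have "t / real n \<in> A" using div t n(3) by (simp add: divisible_set_def)
    moreover have "\<bar>t / real n\<bar> < d" using n(1,3) d(1) by (simp add: field_simps)
    ultimately have "\<bar>S (t / real n)\<bar> \<le> M" using M(2) d(2) by (auto simp: subset_iff)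
    moreover have "S t = real n * S (t / real n)"
      using hom[OF \<open>t / real n \<in> A\<close>, of n] n(3) by simp
    ultimately have "\<bar>S t\<bar> \<le> real n * M" by (simp add: abs_mult mult_left_mono)
    also have "\<dots> \<le> (\<bar>t\<bar> / d + 1) * M" using n(2) M(1) by (intro mult_right_mono) auto
    finally show ?thesis .
  qed
  have "\<bar>S t\<bar> \<le> M / d * \<bar>t\<bar>" if t: "t \<in> A" for t
  proof -
    \<comment> \<open>In \<open>bound\<close> at \<open>real k * t\<close>, everything scales with
      \<open>k\<close> except the summand \<open>M\<close>.\<close>
    have "real k * (\<bar>S t\<bar> - M / d * \<bar>t\<bar>) \<le> M" for k
      using bound[OF subgroup_nat_mult[OF A t], of k] hom[OF t, of k]
      by (simp add: abs_mult algebra_simps)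
    then show ?thesis using le_zero_if_nat_multiples_bounded by fastforce
  qed
  then show thesis using that[of "M / d"] M(1) d(1) by simp
qed

lemma sublinear_on_proportional:
  assumes A: "real_subgroup A" and S: "sublinear_on A S"
    and C: "C \<ge> 0" "\<And>t. t \<in> A \<Longrightarrow> \<bar>S t\<bar> \<le> C * \<bar>t\<bar>"
    and a: "a \<in> A" and b: "b \<in> A" and ab: "b / a > 0"
  shows "S b = b / a * S a"
proof -
  have hom: "S (real n * x) = real n * S x" if "x \<in> A" for x n
    using S that by (simp add: sublinear_on_def)
  \<comment> \<open>Subadditivity applied to \<open>u = (u - v) + v\<close>, in both orders, turns
    the bound at 0 into a Lipschitz estimate on all of \<open>A\<close>.\<close>
  have lip: "\<bar>S x - S y\<bar> \<le> C * \<bar>x - y\<bar>" if "x \<in> A" "y \<in> A" for x y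
  proof -
    have sub: "S u - S v \<le> S (u - v)" if "u \<in> A" "v \<in> A" for u v
      using S subgroup_diff[OF A that] that(2)
      unfolding sublinear_on_def subadditive_on_def by (smt (verit) diff_add_cancel)
    show ?thesis
      using sub[OF that] sub[OF that(2,1)]
        C(2)[OF subgroup_diff[OF A that]] C(2)[OF subgroup_diff[OF A that(2,1)]]
      by (simp add: abs_minus_commute)
  qed
  have "real n * \<bar>S b - b / a * S a\<bar> \<le> C * \<bar>a\<bar> + \<bar>S a\<bar>" for n
  proof -
    define r where "r = real n * (b / a)"
    \<comment> \<open>Since \<open>real n * b = r * a\<close>, rounding \<open>r\<close> down moves
      the point by at most \<open>\<bar>a\<bar>\<close>. Equal signs of \<open>a\<close> and
      \<open>b\<close> make \<open>r\<close> non-negative, so \<open>nat\<close> loses nothing and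
      homogeneity applies to the factor \<open>m\<close>.\<close>
    define m where "m = nat \<lfloor>r\<rfloor>"
    have "r \<ge> 0" using ab unfolding r_def by (intro mult_nonneg_nonneg) auto
    then have m: "\<bar>r - real m\<bar> \<le> 1" unfolding m_def by (simp add: of_nat_nat) linarith
    have nb: "real n * b = r * a" using ab unfolding r_def by auto
    have "\<bar>real n * S b - real m * S a\<bar> \<le> C * \<bar>r * a - real m * a\<bar>"
      using lip[OF subgroup_nat_mult[OF A b, of n] subgroup_nat_mult[OF A a, of m]]
      unfolding hom[OF a] hom[OF b] unfolding nb .
    also have "\<dots> = C * (\<bar>r - real m\<bar> * \<bar>a\<bar>)"
      by (simp add: abs_mult left_diff_distrib flip: abs_mult)
    also have "\<dots> \<le> C * (1 * \<bar>a\<bar>)"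
      using m C(1) by (intro mult_left_mono mult_right_mono) auto
    finally have 1: "\<bar>real n * S b - real m * S a\<bar> \<le> C * \<bar>a\<bar>" by simp
    have "\<bar>real m * S a - r * S a\<bar> = \<bar>r - real m\<bar> * \<bar>S a\<bar>"
      by (simp add: left_diff_distrib abs_minus_commute flip: abs_mult)
    also have "\<dots> \<le> 1 * \<bar>S a\<bar>" using m by (intro mult_right_mono) auto
    finally have 2: "\<bar>real m * S a - r * S a\<bar> \<le> \<bar>S a\<bar>" by simp
    have "real n * (S b - b / a * S a) = real n * S b - r * S a"
      unfolding r_def by (simp only: right_diff_distrib mult.assoc)
    then have "real n * \<bar>S b - b / a * S a\<bar> = \<bar>real n * S b - r * S a\<bar>"
      by (metis abs_mult abs_of_nat)
    also have "\<dots> \<le> C * \<bar>a\<bar> + \<bar>S a\<bar>" using 1 2 by linarith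
    finally show ?thesis .
  qed
  then have "\<bar>S b - b / a * S a\<bar> \<le> 0" by (rule le_zero_if_nat_multiples_bounded)
  then show ?thesis by simp
qed

text \<open>The slopes on the two half-lines are read off at one positive \<open>e\<close> and at
  \<open>- e\<close>. Subadditivity at \<open>e + - e = 0\<close> orders them, which allows a single
  maximum to express both; additivity makes them equal.\<close>

lemma sublinear_on_eq_max:
  assumes A: "real_subgroup A" and dense: "closure A = UNIV" and div: "divisible_set A"
    and lb: "locally_bounded_on A S" and S: "sublinear_on A S"
  shows "\<exists>p q. q \<le> p \<and> (\<forall>a\<in>A. S a = max (p * a) (q * a)) \<and> (additive_on A S \<longrightarrow> p = q)"
proof -
  obtain C where C: "C \<ge> 0" "\<And>t. t \<in> A \<Longrightarrow> \<bar>S t\<bar> \<le> C * \<bar>t\<bar>"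
    using sublinear_on_linear_bound[OF A div lb S] by blast
  have "1 \<in> closure A" using dense by simp
  then obtain e where "e \<in> A" "dist e 1 < 1"
    unfolding closure_approachable by (meson zero_less_one)
  then have e: "e \<in> A" "e > 0" "- e \<in> A"
    using A by (auto simp: dist_real_def real_subgroup_def)
  define p where "p = S e / e"
  define q where "q = - S (- e) / e"
  have S0: "S 0 = 0" using sublinear_on_zero[OF A S] .
  have "S (e + - e) \<le> S e + S (- e)"
    using S e unfolding sublinear_on_def subadditive_on_def by blast
  then have qp: "q \<le> p" using S0 e(2) unfolding p_def q_def by (intro divide_right_mono) auto
  have "S a = max (p * a) (q * a)" if a: "a \<in> A" for a
  proof (cases a "0::real" rule: linorder_cases)
    case less
    then have "a / - e > 0" using e(2) by (intro divide_neg_neg) auto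
    then have "S a = q * a"
      using sublinear_on_proportional[OF A S C e(3) a] by (simp add: q_def)
    then show ?thesis using qp less by (simp add: max_def mult_right_mono_neg)
  next
    case equal
    then show ?thesis using S0 by simp
  next
    case greater
    then have "S a = p * a"
      using sublinear_on_proportional[OF A S C e(1) a] e(2) by (simp add: p_def)
    then show ?thesis using qp greater by (simp add: max_def)
  qed
  moreover have "p = q" if "additive_on A S"
  proof -
    have "S (e + - e) = S e + S (- e)" using that e unfolding additive_on_def by blast
    then have "S e = - S (- e)" using S0 by simp
    then show ?thesis unfolding p_def q_def by simp
  qed
  ultimately show ?thesis using qp by metis
qed

lemma tendsto_sup_inf_near:
  assumes dense: "closure A = UNIV" and f: "isCont f x"
    and S: "\<And>a. a \<in> A \<Longrightarrow> S a = f a"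
  shows "(sup_near A S x \<longlongrightarrow> ereal (f x)) (at_right 0)"
    and "(inf_near A S x \<longlongrightarrow> ereal (f x)) (at_right 0)"
proof -
  have *: "\<forall>\<^sub>F \<delta> in at_right 0.
      ereal (f x - \<epsilon>) \<le> inf_near A S x \<delta> \<and> inf_near A S x \<delta> \<le> sup_near A S x \<delta> \<and>
      sup_near A S x \<delta> \<le> ereal (f x + \<epsilon>)" if \<epsilon>: "\<epsilon> > 0" for \<epsilon>
  proof -
    obtain d where d: "d > 0" "\<And>t. dist t x < d \<Longrightarrow> dist (f t) (f x) < \<epsilon>"
      using f \<epsilon> unfolding continuous_at_eps_delta by blast
    have "\<forall>\<^sub>F \<delta> in at_right 0. 0 < \<delta> \<and> \<delta> < d"
      using eventually_at_right_real[OF d(1)] by simp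
    then show ?thesis
    proof (rule eventually_mono)
      fix \<delta> assume \<delta>: "0 < \<delta> \<and> \<delta> < d"
      have "x \<in> closure A" using dense by simp
      then obtain a where "a \<in> A" "dist a x < \<delta>"
        using \<delta> unfolding closure_approachable by meson
      \<comment> \<open>Over an empty set the infimum would be \<infinity> and the supremum
        -\<infinity>, so the middle inequality needs a point of \<open>A\<close> in the
        ball.\<close>
      then have ne: "ball x \<delta> \<inter> A \<noteq> {}" by (metis IntI dist_commute empty_iff mem_ball)
      have near: "f x - \<epsilon> \<le> S t \<and> S t \<le> f x + \<epsilon>" if "t \<in> ball x \<delta> \<inter> A" for t
      proof -
        have "dist t x < d" using that \<delta> by (simp add: dist_commute)
        from d(2)[OF this] show ?thesis using S that by (auto simp: dist_real_def)
      qed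
      show "ereal (f x - \<epsilon>) \<le> inf_near A S x \<delta> \<and> inf_near A S x \<delta> \<le> sup_near A S x \<delta> \<and>
          sup_near A S x \<delta> \<le> ereal (f x + \<epsilon>)"
        unfolding sup_near_def inf_near_def
        using near ne by (auto intro!: INF_greatest SUP_least INF_le_SUP)
    qed
  qed
  \<comment> \<open>A squeeze with real margins. In the order topology of \<open>ereal\<close> the
    bounds \<open>l\<close> and \<open>u\<close> may be infinite, so a real \<open>r\<close> is
    inserted next to \<open>f x\<close> and its distance to \<open>f x\<close> serves as
    \<open>\<epsilon>\<close>.\<close>
  have lim: "(g \<longlongrightarrow> ereal (f x)) (at_right 0)"
    if g: "\<And>\<epsilon>. \<epsilon> > 0 \<Longrightarrow> \<forall>\<^sub>F \<delta> in at_right (0::real). ereal (f x - \<epsilon>) \<le> g \<delta> \<and> g \<delta> \<le> ereal (f x + \<epsilon>)"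
    for g
  proof (rule order_tendstoI)
    fix l assume "l < ereal (f x)"
    then obtain r where r: "l < ereal r" "r < f x" using ereal_dense2 by (metis less_ereal.simps(1))
    show "\<forall>\<^sub>F \<delta> in at_right 0. l < g \<delta>"
      by (rule eventually_mono[OF g[of "f x - r"]]) (use r in auto)
  next
    fix u assume "ereal (f x) < u"
    then obtain r where r: "ereal r < u" "f x < r" using ereal_dense2 by (metis less_ereal.simps(1))
    show "\<forall>\<^sub>F \<delta> in at_right 0. g \<delta> < u"
      by (rule eventually_mono[OF g[of "r - f x"]]) (use r in auto)
  qed
  show "(sup_near A S x \<longlongrightarrow> ereal (f x)) (at_right 0)"
    by (rule lim, rule eventually_mono[OF *]) (auto intro: order_trans)
  show "(inf_near A S x \<longlongrightarrow> ereal (f x)) (at_right 0)"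
    by (rule lim, rule eventually_mono[OF *]) (auto intro: order_trans)
qed

lemma locally_bounded_on_continuous:
  assumes "\<And>x. isCont f x"
  shows "locally_bounded_on UNIV f"
  unfolding locally_bounded_on_def
proof
  fix x :: real
  have "bounded (f ` cball x 1)"
    using assms by (intro compact_imp_bounded compact_continuous_image
      continuous_at_imp_continuous_on) auto
  then have "bounded (f ` (ball x 1 \<inter> UNIV))"
    by (rule bounded_subset) auto
  then show "\<exists>U. open U \<and> x \<in> U \<and> bounded (f ` (U \<inter> UNIV))"
    by (intro exI[of _ "ball x 1"]) auto
qed

lemma sublinear_on_max: "sublinear_on UNIV (\<lambda>x. max (p * x) (q * x))"
proof -
  have "real n * max (p * x) (q * x) = max (p * (real n * x)) (q * (real n * x))" for n x
    by (simp add: max_mult_distrib_left mult.left_commute)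
  moreover have "max (p * (x + y)) (q * (x + y)) \<le> max (p * x) (q * x) + max (p * y) (q * y)" for x y
    unfolding distrib_left by (intro max.boundedI add_mono) simp_all
  ultimately show ?thesis by (simp add: sublinear_on_def subadditive_on_def)
qed

theorem theorem3:
  fixes A :: "real set" and S :: "real \<Rightarrow> real"
  assumes "real_subgroup A"
    and "closure A = UNIV"
    and "divisible_set A"
    and "locally_bounded_on A S"
    and "sublinear_on A S"
  shows
    "(\<forall>x. (sup_near A S x \<longlongrightarrow> ereal (upper_ext A S x)) (at_right 0)) \<and>
     (\<forall>x. (inf_near A S x \<longlongrightarrow> ereal (lower_ext A S x)) (at_right 0)) \<and>
     locally_bounded_on UNIV (upper_ext A S) \<and>
     locally_bounded_on UNIV (lower_ext A S) \<and>
     subadditive_on UNIV (upper_ext A S) \<and>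
     subadditive_on UNIV (lower_ext A S) \<and>
     sublinear_on UNIV (upper_ext A S) \<and>
     sublinear_on UNIV (lower_ext A S) \<and>
     (\<forall>x. lower_ext A S x \<le> upper_ext A S x) \<and>
     (\<forall>a\<in>A. lower_ext A S a \<le> S a \<and> S a \<le> upper_ext A S a) \<and>
     ((\<forall>x\<in>{0..}. upper_ext A S x = lower_ext A S x) \<and>
      (\<forall>x\<in>{..0}. upper_ext A S x = lower_ext A S x)) \<and>
     (is_linear_on {0..} (upper_ext A S) \<and> is_linear_on {..0} (upper_ext A S) \<and>
      is_linear_on {0..} (lower_ext A S) \<and> is_linear_on {..0} (lower_ext A S) \<and>
      is_linear_on (A \<inter> {0..}) S \<and> is_linear_on (A \<inter> {..0}) S) \<and>
     ((\<forall>a\<in>A. upper_ext A S a = S a) \<and> (\<forall>a\<in>A. lower_ext A S a = S a)) \<and>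
     (additive_on A S \<longrightarrow>
        upper_ext A S = lower_ext A S \<and>
        is_linear_on UNIV (upper_ext A S) \<and>
        (\<forall>a\<in>A. S a = upper_ext A S a) \<and>
        is_linear_on A S)"
proof -
  note A = assms(1) and dense = assms(2)
  obtain p q where qp: "q \<le> p" and SL: "\<And>a. a \<in> A \<Longrightarrow> S a = max (p * a) (q * a)"
    and add: "additive_on A S \<Longrightarrow> p = q"
    using sublinear_on_eq_max[OF assms] by metis
  define L where "L x = max (p * x) (q * x)" for x
  have cont: "isCont L x" for x unfolding L_def by (intro continuous_intros)
  have SL: "S a = L a" if "a \<in> A" for a using SL that by (simp add: L_def)
  note lims = tendsto_sup_inf_near[OF dense cont SL]
  \<comment> \<open>The filter is nontrivial and limits in \<open>ereal\<close> are unique, so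
    convergence to a finite value determines \<open>Lim\<close>, and \<open>real_of_ereal\<close>
    recovers that value.\<close>
  have upper: "upper_ext A S = L"
    unfolding upper_ext_def using tendsto_Lim[OF _ lims(1)] by auto
  have lower: "lower_ext A S = L"
    unfolding lower_ext_def using tendsto_Lim[OF _ lims(2)] by auto
  have sub: "sublinear_on UNIV L" unfolding L_def by (rule sublinear_on_max)
  have pos: "L x = p * x" if "x \<ge> 0" for x
    unfolding L_def by (rule max_absorb1) (rule mult_right_mono[OF qp that])
  have neg: "L x = q * x" if "x \<le> 0" for x
    unfolding L_def by (rule max_absorb2) (rule mult_right_mono_neg[OF qp that])
  have lin: "is_linear_on {0..} L" "is_linear_on {..0} L"
      "is_linear_on (A \<inter> {0..}) S" "is_linear_on (A \<inter> {..0}) S"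
    using pos neg SL by (auto simp: is_linear_on_def)
  \<comment> \<open>For \<open>p = q\<close> the maximum collapses to one linear function on the
    whole line.\<close>
  have lin_add: "is_linear_on UNIV L \<and> is_linear_on A S" if "additive_on A S"
    using add[OF that] SL by (auto simp: is_linear_on_def L_def)
  show ?thesis
    \<comment> \<open>With both extensions replaced by \<open>L\<close>, all comparisons between
      them and with \<open>S\<close> reduce to equalities.\<close>
    unfolding upper lower
    using sub unfolding sublinear_on_def
    by (intro conjI allI ballI impI lims locally_bounded_on_continuous[OF cont] lin)
      (simp_all add: SL lin_add)
qed

end
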